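(* Assume that $A_0^i$ and $A_{22}^i$ are Hurwitz for all $i\in\mathcal I$, and let $\gamma_{11}=1$ and $\gamma_{12}\ne0$. Then there exist $\varepsilon_2^*>0$ and a function $\eta_2:(0,\varepsilon_2^* )\to[0,\infty)$ with $\eta_2(\varepsilon)=\mathcal O(\varepsilon)$ such that for all $\varepsilon\in(0,\varepsilon_2^* )$, for all sequences $(t_k)_{k\ge 0}$ of event times satisfying, for some $\tau^*$ with $$\tau^*>\frac{-\varepsilon}{\lambda_f}\ln(\varepsilon)+\eta_2(\varepsilon),$$ the dwell-time property $\tau_k:=t_{k+1}-t_k\ge\tau^*$ for all $k\in\mathbb N$, and for all sequences $(\sigma_k)_{k\ge0}$ in $\mathcal I$ and $(\nu_k)_{k\ge1}$ in $\mathcal J$, the singularly perturbed hybrid system (H) is globally asymptotically stable.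
   Context: Setting. Let $n_x,n_z\ge1$, $n=n_x+n_z$, let $\varepsilon>0$ be a parameter and $\mathcal I,\mathcal J$ finite nonempty index sets. For each $i\in\mathcal I$, $\mathbf D^i$ is an $n\times n$ diagonal matrix with $n_z$ diagonal entries equal to $\varepsilon$ and the other $n_x$ equal to $1$ (positions may depend on $i$), and $S_i$ is a permutation matrix with $S_i\mathbf D^iS_i^\top=\mathrm{diag}(I_{n_x},\varepsilon I_{n_z})$. Let $\mathbf A^i\in\mathbb R^{n\times n}$ ($i\in\mathcal I$) and $\mathbf J^j\in\mathbb R^{n\times n}$ ($j\in\mathcal J$) be given (independent of $\varepsilon$), and set $A^i=S_i\mathbf A^iS_i^\top$, $J^{i\stackrel{j}{\to}i'}=S_{i'}\mathbf J^jS_i^\top$ for $i,i'\in\mathcal I$, $j\in\mathcal J$. Write in blocks of sizes $n_x,n_z$: $$A^i=\begin{pmatrix} A^i_{11} & A^i_{12} \\ A^i_{21} & A^i_{22} \end{pmatrix},$$ with $A_{22}^i$ non-singular. Set $A_0^i=A_{11}^i-A_{12}^i(A_{22}^i)^{-1}A_{21}^i$, $B_1^i=A_{12}^i$, $B_2^i=(A_{22}^i)^{-1}A_{21}^iA_0^i$, $B_3^i=(A_{22}^i)^{-1}A_{21}^iA_{12}^i$, $$P_i=\begin{pmatrix} I_{n_x} & 0 \\ (A_{22}^i)^{-1}A_{21}^i & I_{n_z} \end{pmatrix},\qquad R^{i\stackrel{j}{\to}i'}=P_{i'}J^{i\stackrel{j}{\to}i'}P_i^{-1}=\begin{pmatrix}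 R_{11}^{i\stackrel{j}{\to}i'} & R_{12}^{i\stackrel{j}{\to}i'} \\ R_{21}^{i\stackrel{j}{\to}i'} & R_{22}^{i\stackrel{j}{\to}i'} \end{pmatrix}.$$ A sequence of event times is a strictly increasing unbounded sequence $0=t_0<t_1<\cdots$. Given such a sequence, modes $\sigma_k\in\mathcal I$ ($k\ge0$) and $\nu_k\in\mathcal J$ ($k\ge1$), system (H) with state $(x(t),y(t))\in\mathbb R^{n_x}\times\mathbb R^{n_z}$ is, for $t\in[t_k,t_{k+1})$, $k\in\mathbb N$, $$\dot x=A_0^{\sigma_k}x+B_1^{\sigma_k}y,\qquad \varepsilon\dot y=\varepsilon B_2^{\sigma_k}x+(A_{22}^{\sigma_k}+\varepsilon B_3^{\sigma_k})y,$$ and, for $k\ge1$, $\begin{pmatrix} x(t_k) \\ y(t_k) \end{pmatrix}=R^{\sigma_{k-1}\stackrel{\nu_k}{\to}\sigma_k}\begin{pmatrix} x(t_k^-) \\ y(t_k^-) \end{pmatrix}$, where $t_k^-$ denotes the left limit. Globally asymptotically stable means: the origin is Lyapunov stable (for every $\rho>0$ there is $\delta>0$ such that initial states at time $0$ of norm $<\delta$ give solutions of norm $<\rho$ for all $t\ge0$) and every solution tends to $0$ as $t\to\infty$. Constants. Since $A_0^i,A_{22}^i$ are Hurwitz, fix symmetric matrices $Q_s^i\ge I_{n_x}$, $Q_f^i\ge I_{n_z}$ and numbers $\lambda_s^i,\lambda_f^i>0$ with $A_0^{i\top}Q_s^i+Q_s^iA_0^i\le-2\lambda_s^iQ_s^i$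 and $A_{22}^{i\top}Q_f^i+Q_f^iA_{22}^i\le-2\lambda_f^iQ_f^i$ for all $i\in\mathcal I$. Put $\lambda_s=\min_i\lambda_s^i$, $\lambda_f=\min_i\lambda_f^i$ and, with $\|\cdot\|$ the spectral norm and maxima over $i,i'\in\mathcal I$, $j\in\mathcal J$, $$\gamma_{11}=\max\|(Q_s^{i'})^{1/2}R_{11}^{i\stackrel{j}{\to}i'}(Q_s^i)^{-1/2}\|,\qquad \gamma_{12}=\max\|(Q_s^{i'})^{1/2}R_{12}^{i\stackrel{j}{\to}i'}(Q_f^i)^{-1/2}\|.$$ $\eta(\varepsilon)=\mathcal O(\varepsilon)$ for a function $\eta$ on $(0,\varepsilon^* )$ means: there are $\varepsilon_0\in(0,\varepsilon^* )$ and $c>0$ with $|\eta(\varepsilon)|\le c\varepsilon$ for all $\varepsilon\in(0,\varepsilon_0)$. *)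

theory Defs
  imports "HOL-Analysis.Analysis"
begin

text \<open>
  Matrices of size n = nx + nz are indexed by the sum type \<open>'nx + 'nz\<close>: \<open>Inl\<close> gives the
  first nx indices (slow block), \<open>Inr\<close> the last nz indices (fast block).
\<close>

definition join_vec :: "real^'nx \<Rightarrow> real^'nz \<Rightarrow> real^('nx::finite + 'nz::finite)" where
  "join_vec x y = (\<chi> k. case k of Inl a \<Rightarrow> x $ a | Inr b \<Rightarrow> y $ b)"

definition four_blocks ::
  "real^'nx^'nx \<Rightarrow> real^'nz^'nx \<Rightarrow> real^'nx^'nz \<Rightarrow> real^'nz^'nz
    \<Rightarrow> real^('nx::finite + 'nz::finite)^('nx + 'nz)" where
  "four_blocks M11 M12 M21 M22 =
    (\<chi> k l. case k of
       Inl a \<Rightarrow> (case l of Inl c \<Rightarrow> M11 $ a $ c | Inr d \<Rightarrow> M12 $ a $ d)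
     | Inr b \<Rightarrow> (case l of Inl c \<Rightarrow> M21 $ b $ c | Inr d \<Rightarrow> M22 $ b $ d))"

definition blk11 :: "real^('nx::finite + 'nz::finite)^('nx + 'nz) \<Rightarrow> real^'nx^'nx" where
  "blk11 M = (\<chi> a b. M $ Inl a $ Inl b)"

definition blk12 :: "real^('nx::finite + 'nz::finite)^('nx + 'nz) \<Rightarrow> real^'nz^'nx" where
  "blk12 M = (\<chi> a b. M $ Inl a $ Inr b)"

definition blk21 :: "real^('nx::finite + 'nz::finite)^('nx + 'nz) \<Rightarrow> real^'nx^'nz" where
  "blk21 M = (\<chi> a b. M $ Inr a $ Inl b)"

definition blk22 :: "real^('nx::finite + 'nz::finite)^('nx + 'nz) \<Rightarrow> real^'nz^'nz" where
  "blk22 M = (\<chi> a b. M $ Inr a $ Inr b)"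

definition permutation_matrix :: "real^'n^'n::finite \<Rightarrow> bool" where
  "permutation_matrix S \<longleftrightarrow> (\<exists>p. bij p \<and> S = (\<chi> a b. if b = p a then 1 else 0))"

text \<open>\<open>Z\<close> is the set of positions of the diagonal entries equal to \<open>\<epsilon>\<close>.\<close>

definition scaling_matrix :: "'n set \<Rightarrow> real \<Rightarrow> real^'n^'n::finite" where
  "scaling_matrix Z \<epsilon> = (\<chi> a b. if a = b then (if a \<in> Z then \<epsilon> else 1) else 0)"

definition hurwitz :: "real^'n^'n::finite \<Rightarrow> bool" where
  "hurwitz M \<longleftrightarrow>
    (\<forall>(\<mu>::complex) v. v \<noteq> 0 \<and> map_matrix complex_of_real M *v v = \<mu> *s v \<longrightarrow> Re \<mu> < 0)"

definition symmetric_matrix :: "real^'n^'n::finite \<Rightarrow> bool" where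
  "symmetric_matrix M \<longleftrightarrow> transpose M = M"

text \<open>The order on symmetric matrices: \<open>N - M\<close> is positive semidefinite.\<close>

definition loewner_le :: "real^'n^'n \<Rightarrow> real^'n^'n::finite \<Rightarrow> bool" where
  "loewner_le M N \<longleftrightarrow> (\<forall>v. 0 \<le> v \<bullet> ((N - M) *v v))"

text \<open>
  For a symmetric positive semidefinite \<open>Q\<close>, the matrix chosen here exists and is unique;
  the value is not meaningful for other \<open>Q\<close>.
\<close>

definition matrix_sqrt :: "real^'n^'n \<Rightarrow> real^'n^'n::finite" where
  "matrix_sqrt Q = (SOME M. symmetric_matrix M \<and> loewner_le 0 M \<and> M ** M = Q)"

definition spectral_norm :: "real^'n^'m::finite \<Rightarrow> real" where
  "spectral_norm M = onorm (\<lambda>v. M *v v)"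

definition mat_A0 :: "real^('nx::finite + 'nz::finite)^('nx + 'nz) \<Rightarrow> real^'nx^'nx" where
  "mat_A0 M = blk11 M - blk12 M ** matrix_inv (blk22 M) ** blk21 M"

definition mat_B1 :: "real^('nx::finite + 'nz::finite)^('nx + 'nz) \<Rightarrow> real^'nz^'nx" where
  "mat_B1 M = blk12 M"

definition mat_B2 :: "real^('nx::finite + 'nz::finite)^('nx + 'nz) \<Rightarrow> real^'nx^'nz" where
  "mat_B2 M = matrix_inv (blk22 M) ** blk21 M ** mat_A0 M"

definition mat_B3 :: "real^('nx::finite + 'nz::finite)^('nx + 'nz) \<Rightarrow> real^'nz^'nz" where
  "mat_B3 M = matrix_inv (blk22 M) ** blk21 M ** blk12 M"

definition mat_P ::
  "real^('nx::finite + 'nz::finite)^('nx + 'nz) \<Rightarrow> real^('nx + 'nz)^('nx + 'nz)" where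
  "mat_P M = four_blocks (mat 1) 0 (matrix_inv (blk22 M) ** blk21 M) (mat 1)"

definition event_times :: "(nat \<Rightarrow> real) \<Rightarrow> bool" where
  "event_times t \<longleftrightarrow> t 0 = 0 \<and> strict_mono t \<and> \<not> bdd_above (range t)"

text \<open>
  In the flow condition the derivative is taken within the half-open interval, so it is the
  right derivative at an event time. \<open>R i j i'\<close> is the jump matrix from mode \<open>i\<close> to \<open>i'\<close> under \<open>j\<close>,
  and \<open>\<nu> 0\<close> is unused.
\<close>

definition solution_H ::
  "('i \<Rightarrow> real^('nx::finite + 'nz::finite)^('nx + 'nz))
    \<Rightarrow> ('i \<Rightarrow> 'j \<Rightarrow> 'i \<Rightarrow> real^('nx + 'nz)^('nx + 'nz))
    \<Rightarrow> real \<Rightarrow> (nat \<Rightarrow> real) \<Rightarrow> (nat \<Rightarrow> 'i) \<Rightarrow> (nat \<Rightarrow> 'j)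
    \<Rightarrow> (real \<Rightarrow> real^'nx) \<Rightarrow> (real \<Rightarrow> real^'nz) \<Rightarrow> bool" where
  "solution_H A R \<epsilon> t \<sigma> \<nu> x y \<longleftrightarrow>
    (\<forall>k. \<forall>s\<in>{t k..<t (Suc k)}. \<exists>dx dy.
       (x has_vector_derivative dx) (at s within {t k..<t (Suc k)}) \<and>
       (y has_vector_derivative dy) (at s within {t k..<t (Suc k)}) \<and>
       dx = mat_A0 (A (\<sigma> k)) *v x s + mat_B1 (A (\<sigma> k)) *v y s \<and>
       \<epsilon> *\<^sub>R dy = \<epsilon> *\<^sub>R (mat_B2 (A (\<sigma> k)) *v x s)
          + (blk22 (A (\<sigma> k)) + \<epsilon> *\<^sub>R mat_B3 (A (\<sigma> k))) *v y s) \<and>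
    (\<forall>k\<ge>1. \<exists>xl yl.
       (x \<longlongrightarrow> xl) (at_left (t k)) \<and> (y \<longlongrightarrow> yl) (at_left (t k)) \<and>
       join_vec (x (t k)) (y (t k)) = R (\<sigma> (k - 1)) (\<nu> k) (\<sigma> k) *v join_vec xl yl)"

text \<open>
  Here \<open>Sol\<close> is the set of solutions of a system. The norm on pairs is the Euclidean one.
\<close>

definition globally_asymptotically_stable ::
  "(real \<Rightarrow> 'v::real_normed_vector) set \<Rightarrow> bool" where
  "globally_asymptotically_stable Sol \<longleftrightarrow>
    (\<forall>\<rho>>0. \<exists>\<delta>>0. \<forall>z\<in>Sol. norm (z 0) < \<delta> \<longrightarrow> (\<forall>s\<ge>0. norm (z s) < \<rho>)) \<and>
    (\<forall>z\<in>Sol. (z \<longlongrightarrow> 0) at_top)"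

definition O_eps :: "real \<Rightarrow> (real \<Rightarrow> real) \<Rightarrow> bool" where
  "O_eps \<epsilon>s \<eta> \<longleftrightarrow>
    (\<exists>\<epsilon>0\<in>{0<..<\<epsilon>s}. \<exists>c>0. \<forall>\<epsilon>\<in>{0<..<\<epsilon>0}. \<bar>\<eta> \<epsilon>\<bar> \<le> c * \<epsilon>)"

end

theory Submission
  imports Defs "HOL-Real_Asymp.Real_Asymp"
begin

text \<open>
  Measure the slow and fast states by \<open>u = |Qs\<^sup>1\<^sup>/\<^sup>2 x|\<close> and \<open>v = |Qf\<^sup>1\<^sup>/\<^sup>2 y|\<close>. For one constant \<open>C\<close>, with
  \<open>l = min ls\<close> and \<open>L = min lf\<close>, flows satisfy \<open>u' \<le> - l u + C v\<close> and \<open>v' \<le> - (L/\<epsilon> - C) v + C u\<close>,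
  and \<open>gamma11 = 1\<close> gives the jump bounds \<open>u\<^sup>+ \<le> u + C v\<close> and \<open>v\<^sup>+ \<le> C (u + v)\<close>. A flow of duration at
  least \<open>T = - (\<epsilon>/L) ln \<epsilon>\<close> multiplies the initial fast component by \<open>O(\<epsilon>)\<close> and leaves
  \<open>v = O(\<epsilon>) u\<close> apart from it, so flow and jump together cost \<open>u\<close> a factor \<open>1 + O(\<epsilon>)\<close>, while the slow
  decay gains \<open>exp (- l T / 2) = 1 - (l/2L) \<epsilon> |ln \<epsilon>| + \<dots>\<close>. The logarithm wins for small \<open>\<epsilon>\<close>, so
  \<open>u\<close> and \<open>v\<close> contract by a fixed factor from event to event, already with \<open>\<eta>2 = 0\<close>.
\<close>

subsection \<open>Planar comparison and decay of hybrid solutions\<close>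

text \<open>
  The hypotheses concern squares because the norms \<open>u\<close> and \<open>v\<close> need not be differentiable where they
  vanish; at a first contact with the positive barriers only the squares have to be differentiated.
\<close>

lemma comparison:
  fixes u v U V :: "real \<Rightarrow> real"
  assumes du: "\<And>s. s \<in> {a..<b} \<Longrightarrow>
      \<exists>f. ((\<lambda>s. (u s)\<^sup>2) has_real_derivative f) (at s within {a..<b}) \<and> f \<le> 2 * u s * (- p * u s + C * v s)"
    and dv: "\<And>s. s \<in> {a..<b} \<Longrightarrow>
      \<exists>g. ((\<lambda>s. (v s)\<^sup>2) has_real_derivative g) (at s within {a..<b}) \<and> g \<le> 2 * v s * (- r * v s + C * u s)"
    and dU: "\<And>s. (U has_real_derivative U' s) (at s)"
    and dV: "\<And>s. (V has_real_derivative V' s) (at s)"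
    and U': "\<And>s. a \<le> s \<Longrightarrow> U' s > - p * U s + C * V s"
    and V': "\<And>s. a \<le> s \<Longrightarrow> V' s > - r * V s + C * U s"
    and pos: "\<And>s. a \<le> s \<Longrightarrow> U s > 0" "\<And>s. a \<le> s \<Longrightarrow> V s > 0"
    and nonneg: "\<And>s. u s \<ge> 0" "\<And>s. v s \<ge> 0" "C \<ge> 0"
    and init: "u a < U a" "v a < V a"
    and s: "s \<in> {a..<b}"
  shows "u s < U s \<and> v s < V s"
proof (rule ccontr)
  assume contr: "\<not> (u s < U s \<and> v s < V s)"
  define f where "f = (\<lambda>s. (u s)\<^sup>2 - (U s)\<^sup>2)"
  define g where "g = (\<lambda>s. (v s)\<^sup>2 - (V s)\<^sup>2)"
  \<comment> \<open>From \<open>a\<close> on, \<open>h\<close> is negative exactly while both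
    \<open>u\<close> and \<open>v\<close> lie strictly below their barriers, so its first zero is
    the first contact with either barrier.\<close>
  define h where "h = (\<lambda>s. max (f s) (g s))"
  have "continuous_on {a..<b} (\<lambda>s. (u s)\<^sup>2)" "continuous_on {a..<b} (\<lambda>s. (v s)\<^sup>2)"
    unfolding continuous_on_eq_continuous_within using du dv DERIV_continuous by blast+
  moreover have "continuous_on {a..<b} (\<lambda>s. (U s)\<^sup>2)" "continuous_on {a..<b} (\<lambda>s. (V s)\<^sup>2)"
    by (intro continuous_on_power continuous_at_imp_continuous_on ballI DERIV_isCont[OF dU] DERIV_isCont[OF dV])+
  ultimately have "continuous_on {a..<b} h"
    unfolding h_def f_def g_def by (intro continuous_on_max continuous_on_diff)
  then have conth: "continuous_on {a..s} h"
    using s by (elim continuous_on_subset) auto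
  have fneg: "f s < 0 \<longleftrightarrow> u s < U s" and gneg: "g s < 0 \<longleftrightarrow> v s < V s" if "a \<le> s" for s
    using pos[OF that] nonneg(1,2)[of s]
    by (auto simp: f_def g_def intro!: power_strict_mono elim!: power2_less_imp_less)
  have ha: "h a < 0" using fneg[of a] gneg[of a] init by (simp add: h_def)
  have hs: "h s \<ge> 0" using contr fneg[of s] gneg[of s] s by (auto simp: h_def)
  define Z where "Z = {r \<in> {a..s}. h r = 0}"
  have ne: "Z \<noteq> {}"
    using IVT'[of h a 0 s] ha hs conth s by (auto simp: Z_def)
  have "closed Z"
    unfolding Z_def using conth by (intro continuous_closed_preimage_constant) auto
  define T where "T = Inf Z"
  have bdd: "bdd_below Z" by (auto simp: Z_def)
  have TZ: "T \<in> Z" unfolding T_def using closed_contains_Inf[OF ne bdd \<open>closed Z\<close>] .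
  then have T: "a < T" "T \<le> s" "h T = 0" using ha by (auto simp: Z_def order_le_less)
  have before: "h r < 0" if "a \<le> r" "r < T" for r
  proof (rule ccontr)
    assume "\<not> h r < 0"
    moreover have "continuous_on {a..r} h" using conth that T by (elim continuous_on_subset) auto
    ultimately have "\<exists>q\<ge>a. q \<le> r \<and> h q = 0"
      using ha that by (intro IVT') auto
    then obtain q where q: "a \<le> q" "q \<le> r" "h q = 0" by blast
    then have "q \<in> Z" using that T by (auto simp: Z_def)
    then show False using cInf_lower[OF _ bdd, of q] q that by (auto simp: T_def)
  qed
  have Tab: "T \<in> {a..<b}" using T s by auto
  \<comment> \<open>Such a \<open>k\<close> with negative derivative at \<open>T\<close> would be
    positive just to the left of \<open>T\<close>, yet it stays below \<open>h\<close>, which is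
    negative there. \<open>T > a\<close> leaves room on the left.\<close>
  have no_neg: False
    if k: "k T = 0" "(k has_real_derivative D) (at T within {a..<b})" "D < 0" "\<And>r. k r \<le> h r" for k D
  proof -
    obtain d where d: "d > 0" "\<And>e. e > 0 \<Longrightarrow> T - e \<in> {a..<b} \<Longrightarrow> e < d \<Longrightarrow> k T < k (T - e)"
      using has_real_derivative_neg_dec_left[OF k(2,3)] by blast
    define e where "e = min (d/2) ((T - a)/2)"
    have "e > 0" "e < d" "a \<le> T - e" "T - e < T" "T - e < b" using d T Tab by (auto simp: e_def min_def field_simps)
    then show False using d(2)[of e] k(1) k(4)[of "T - e"] before[of "T - e"] by auto
  qed
  have le: "u T \<le> U T" "v T \<le> V T"
    using T fneg gneg pos[of T] nonneg(1,2)[of T]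
    by (auto simp: h_def f_def g_def max_def power2_le_iff_abs_le split: if_splits)
  consider "f T = 0" | "g T = 0" using T(3) by (auto simp: h_def max_def split: if_splits)
  then show False
  proof cases
    case 1
    then have eq: "u T = U T" using pos(1)[of T] nonneg(1)[of T] T by (simp add: f_def)
    obtain D where D: "((\<lambda>s. (u s)\<^sup>2) has_real_derivative D) (at T within {a..<b})"
      "D \<le> 2 * u T * (- p * u T + C * v T)" using du[OF Tab] by blast
    have "((\<lambda>s. (U s)\<^sup>2) has_real_derivative 2 * U T * U' T) (at T within {a..<b})"
      by (auto intro!: derivative_eq_intros has_field_derivative_at_within[OF dU])
    then have "(f has_real_derivative (D - 2 * U T * U' T)) (at T within {a..<b})"
      unfolding f_def by (intro DERIV_diff D(1))
    moreover have "D < 2 * U T * U' T"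
    proof -
      \<comment> \<open>The coupling coefficient \<open>C\<close> is nonnegative, so replacing
        \<open>v T\<close> by the larger \<open>V T\<close> can only raise the right-hand side; the
        strict barrier inequality then separates the slopes.\<close>
      have "2 * u T * (- p * u T + C * v T) \<le> 2 * U T * (- p * U T + C * V T)"
        unfolding eq using le nonneg pos(1)[of T] T by (intro mult_left_mono add_left_mono) auto
      also have "\<dots> < 2 * U T * U' T" using U'[of T] pos(1)[of T] T by (intro mult_strict_left_mono) auto
      finally show ?thesis using D(2) by simp
    qed
    ultimately show False by (intro no_neg[of f "D - 2 * U T * U' T", OF 1]) (auto simp: h_def)
  next
    case 2
    then have eq: "v T = V T" using pos(2)[of T] nonneg(2)[of T] T by (simp add: g_def)
    obtain D where D: "((\<lambda>s. (v s)\<^sup>2) has_real_derivative D) (at T within {a..<b})"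
      "D \<le> 2 * v T * (- r * v T + C * u T)" using dv[OF Tab] by blast
    have "((\<lambda>s. (V s)\<^sup>2) has_real_derivative 2 * V T * V' T) (at T within {a..<b})"
      by (auto intro!: derivative_eq_intros has_field_derivative_at_within[OF dV])
    then have "(g has_real_derivative (D - 2 * V T * V' T)) (at T within {a..<b})"
      unfolding g_def by (intro DERIV_diff D(1))
    moreover have "D < 2 * V T * V' T"
    proof -
      have "2 * v T * (- r * v T + C * u T) \<le> 2 * V T * (- r * V T + C * U T)"
        unfolding eq using le nonneg pos(2)[of T] T by (intro mult_left_mono add_left_mono) auto
      also have "\<dots> < 2 * V T * V' T" using V'[of T] pos(2)[of T] T by (intro mult_strict_left_mono) auto
      finally show ?thesis using D(2) by simp
    qed
    ultimately show False by (intro no_neg[of g "D - 2 * V T * V' T", OF 2]) (auto simp: h_def)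
  qed
qed

text \<open>The barriers combine a slow exponential \<open>E\<close> of rate \<open>l/2\<close> and
  a fast one \<open>F\<close> of rate \<open>\<mu>\<close>. In \<open>V\<close>, the term
  \<open>m * \<rho> * F\<close> carries the initial fast component and
  \<open>\<kappa> * c * E\<close> the part of \<open>v\<close> driven by \<open>u\<close>. Matching
  coefficients of \<open>E\<close> and \<open>F\<close> in the two differential inequalities leads
  to the two conditions on \<open>\<kappa>\<close>.\<close>

lemma flow_bound:
  fixes u v :: "real \<Rightarrow> real"
  assumes du: "\<And>s. s \<in> {t0..<t1} \<Longrightarrow>
      \<exists>f. ((\<lambda>s. (u s)\<^sup>2) has_real_derivative f) (at s within {t0..<t1}) \<and> f \<le> 2 * u s * (- l * u s + C * v s)"
    and dv: "\<And>s. s \<in> {t0..<t1} \<Longrightarrow>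
      \<exists>g. ((\<lambda>s. (v s)\<^sup>2) has_real_derivative g) (at s within {t0..<t1}) \<and> g \<le> 2 * v s * (- \<mu> * v s + C * u s)"
    and nonneg: "\<And>s. u s \<ge> 0" "\<And>s. v s \<ge> 0"
    and pos: "C > 0" "l > 0" "\<mu> > l" "\<kappa> > 0" "\<rho> > 0" "m > 0"
    and \<kappa>: "C * \<kappa> \<le> l / 2" "(\<mu> - l) * \<kappa> > C"
    and init: "u t0 < \<rho>" "v t0 < m * \<rho>"
    and s: "s \<in> {t0..<t1}"
  shows "u s < exp (- (l/2) * (s - t0)) * (1 + \<kappa> * m) * \<rho> \<and>
         v s < (m * exp (- \<mu> * (s - t0)) + \<kappa> * (exp (- (l/2) * (s - t0)) * (1 + \<kappa> * m))) * \<rho>"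
proof -
  \<comment> \<open>This \<open>c\<close> makes \<open>U t0 = \<rho>\<close>; \<open>V t0\<close>
    exceeds \<open>m * \<rho>\<close> by \<open>\<kappa> * c\<close>.\<close>
  define c where "c = (1 + \<kappa> * m) * \<rho>"
  define E where "E = (\<lambda>s. exp (- (l/2) * (s - t0)))"
  define F where "F = (\<lambda>s. exp (- \<mu> * (s - t0)))"
  \<comment> \<open>The subtracted fast term offsets the part of \<open>C * V\<close> proportional
    to \<open>F\<close>: its derivative is the positive
    \<open>\<mu> * \<kappa> * m * \<rho> * F\<close>.\<close>
  define U where "U = (\<lambda>s. c * E s - \<kappa> * m * \<rho> * F s)"
  define V where "V = (\<lambda>s. m * \<rho> * F s + \<kappa> * c * E s)"
  have c: "c > 0" "c = \<rho> + \<kappa> * m * \<rho>" using pos by (simp_all add: c_def algebra_simps add_pos_pos)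
  have E: "E s > 0" and F: "F s > 0" for s by (simp_all add: E_def F_def)
  have dE: "(E has_real_derivative (- (l/2) * E s)) (at s)" for s
    unfolding E_def by (auto intro!: derivative_eq_intros)
  have dF: "(F has_real_derivative (- \<mu> * F s)) (at s)" for s
    unfolding F_def by (auto intro!: derivative_eq_intros)
  have FE: "F s \<le> E s" if "t0 \<le> s" for s
    unfolding E_def F_def using that pos mult_right_mono[of "l/2" \<mu> "s - t0"] by simp
  have "u s < U s \<and> v s < V s"
  proof (rule comparison[OF du dv _ _ _ _ _ _ nonneg _ _ _ s,
      where U' = "\<lambda>s. c * (- (l/2) * E s) - \<kappa> * m * \<rho> * (- \<mu> * F s)" and V' = "\<lambda>s. m * \<rho> * (- \<mu> * F s) + \<kappa> * c * (- (l/2) * E s)"])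
    fix s
    show "(U has_real_derivative c * (- (l/2) * E s) - \<kappa> * m * \<rho> * (- \<mu> * F s)) (at s)"
      unfolding U_def by (auto intro!: derivative_eq_intros dE dF)
    show "(V has_real_derivative m * \<rho> * (- \<mu> * F s) + \<kappa> * c * (- (l/2) * E s)) (at s)"
      unfolding V_def by (auto intro!: derivative_eq_intros dE dF)
  next
    fix s assume s: "t0 \<le> s"
    have "C * \<kappa> * (c * E s) \<le> l/2 * (c * E s)" using \<kappa> c E[of s] by (intro mult_right_mono) auto
    moreover have "C * (m * \<rho> * F s) < (\<mu> - l) * \<kappa> * (m * \<rho> * F s)" using \<kappa> pos F[of s] by (intro mult_strict_right_mono) auto
    ultimately show "- l * U s + C * V s < c * (- (l/2) * E s) - \<kappa> * m * \<rho> * (- \<mu> * F s)"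
      unfolding U_def V_def by (simp add: algebra_simps)
    have "l/2*\<kappa> > 0" using pos by simp
    then have "(\<mu> - l/2) * \<kappa> > C" using \<kappa> by (simp add: algebra_simps)
    then have "C * (c * E s) < (\<mu> - l/2) * \<kappa> * (c * E s)" using c E[of s] by (intro mult_strict_right_mono) auto
    moreover have "0 < C * (\<kappa> * m * \<rho> * F s)" using pos F[of s] by simp
    ultimately show "- \<mu> * V s + C * U s < m * \<rho> * (- \<mu> * F s) + \<kappa> * c * (- (l/2) * E s)"
      unfolding U_def V_def by (simp add: algebra_simps)
    \<comment> \<open>Positivity rests on
      \<open>U = \<rho> * E + \<kappa> * m * \<rho> * (E - F)\<close> and
      \<open>F \<le> E\<close>.\<close>
    have "\<kappa> * m * \<rho> * F s \<le> \<kappa> * m * \<rho> * E s" using pos FE[OF s] by (intro mult_left_mono) auto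
    moreover have "\<rho> * E s > 0" using pos E[of s] by simp
    ultimately show "U s > 0" unfolding U_def c(2) by (simp add: algebra_simps)
    show "V s > 0" unfolding V_def using pos c E[of s] F[of s] by (simp add: add_pos_pos)
  next
    show "u t0 < U t0" using init by (simp add: U_def E_def F_def c(2))
    have "\<kappa> * c > 0" using pos c by simp
    then show "v t0 < V t0" using init by (simp add: V_def E_def F_def)
  qed (use pos in auto)
  moreover have "U s \<le> E s * (1 + \<kappa> * m) * \<rho>"
    using pos F[of s] by (simp add: U_def c_def algebra_simps)
  moreover have "V s = (m * F s + \<kappa> * (E s * (1 + \<kappa> * m))) * \<rho>"
    by (simp add: V_def c_def algebra_simps)
  ultimately show ?thesis unfolding E_def F_def by auto
qed

text \<open>With this \<open>T\<close>, \<open>exp (- \<mu> * T) = \<epsilon> * exp (- C *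
  \<epsilon> / L * ln \<epsilon>)\<close> is of order \<open>\<epsilon>\<close>. The product
  \<open>(\<mu> - l) * \<kappa>\<close> tends to \<open>2 * (C + 1)\<close>, and the left side of
  the last inequality to \<open>C\<close>, below \<open>m\<close>. The contraction inequality before
  it is the delicate one: its left side tends to \<open>1\<close>, and only the
  \<open>\<epsilon> * ln \<epsilon>\<close> term from the slow exponential brings it below.\<close>

lemma small_parameter:
  fixes C L l :: real
  assumes "C > 0" "L > 0" "l > 0"
  shows "\<exists>\<epsilon>0>0. \<forall>\<epsilon>. 0 < \<epsilon> \<and> \<epsilon> < \<epsilon>0 \<longrightarrow>
    (let \<kappa> = 2 * (C + 1) / L * \<epsilon>; m = 2 * C + 1; \<mu> = L / \<epsilon> - C; T = - \<epsilon> / L * ln \<epsilon>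
     in \<mu> > l \<and> C * \<kappa> \<le> l / 2 \<and> (\<mu> - l) * \<kappa> > C \<and> T \<ge> 0 \<and>
        exp (- (l/2) * T) * (1 + \<kappa> * m) * (1 + C * \<kappa>) + C * m * exp (- \<mu> * T) < 1 \<and>
        C * (1 + \<kappa> * m) + C * (m * exp (- \<mu> * T) + \<kappa> * (1 + \<kappa> * m)) < m)"
proof -
  have "eventually (\<lambda>\<epsilon>. L / \<epsilon> - C > l) (at_right 0)"
    "eventually (\<lambda>\<epsilon>. C * (2 * (C + 1) / L * \<epsilon>) \<le> l / 2) (at_right 0)"
    "eventually (\<lambda>\<epsilon>. (L / \<epsilon> - C - l) * (2 * (C + 1) / L * \<epsilon>) > C) (at_right 0)"
    "eventually (\<lambda>\<epsilon>. - \<epsilon> / L * ln \<epsilon> \<ge> 0) (at_right 0)"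
    "eventually (\<lambda>\<epsilon>. exp (- (l/2) * (- \<epsilon> / L * ln \<epsilon>)) * (1 + 2 * (C + 1) / L * \<epsilon> * (2 * C + 1))
        * (1 + C * (2 * (C + 1) / L * \<epsilon>))
      + C * (2 * C + 1) * exp (- (L / \<epsilon> - C) * (- \<epsilon> / L * ln \<epsilon>)) < 1) (at_right 0)"
    "eventually (\<lambda>\<epsilon>. C * (1 + 2 * (C + 1) / L * \<epsilon> * (2 * C + 1))
      + C * ((2 * C + 1) * exp (- (L / \<epsilon> - C) * (- \<epsilon> / L * ln \<epsilon>))
        + 2 * (C + 1) / L * \<epsilon> * (1 + 2 * (C + 1) / L * \<epsilon> * (2 * C + 1))) < 2 * C + 1) (at_right 0)"
    using assms by real_asymp+
  then have "eventually (\<lambda>\<epsilon>.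
    (let \<kappa> = 2 * (C + 1) / L * \<epsilon>; m = 2 * C + 1; \<mu> = L / \<epsilon> - C; T = - \<epsilon> / L * ln \<epsilon>
     in \<mu> > l \<and> C * \<kappa> \<le> l / 2 \<and> (\<mu> - l) * \<kappa> > C \<and> T \<ge> 0 \<and>
        exp (- (l/2) * T) * (1 + \<kappa> * m) * (1 + C * \<kappa>) + C * m * exp (- \<mu> * T) < 1 \<and>
        C * (1 + \<kappa> * m) + C * (m * exp (- \<mu> * T) + \<kappa> * (1 + \<kappa> * m)) < m)) (at_right 0)"
    unfolding Let_def by (intro eventually_conj)
  then show ?thesis
    unfolding eventually_at_right_field by blast
qed

text \<open>Unboundedness excludes accumulation of events, so a least \<open>j\<close> with
  \<open>s < t j\<close> exists; \<open>n < j\<close> makes \<open>j - 1\<close> a genuine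
  predecessor.\<close>

lemma event_times_locate:
  assumes "event_times t" "t n \<le> s"
  shows "\<exists>k\<ge>n. s \<in> {t k..<t (Suc k)}"
proof -
  have "\<exists>j. s < t j"
    using assms(1) unfolding event_times_def bdd_above_def by (metis not_less rangeE)
  then obtain j where j: "s < t j" "\<And>i. i < j \<Longrightarrow> t i \<le> s"
    using exists_least_iff[of "\<lambda>j. s < t j"] by (auto simp: not_less)
  have mono: "mono t" using assms(1) by (simp add: event_times_def strict_mono_mono)
  have "n < j" using j(1) assms(2) monoD[OF mono, of j n] by (meson leD leI order_less_le_trans)
  then show ?thesis using j by (intro exI[of _ "j - 1"]) auto
qed

text \<open>Induction over events keeps the pair at \<open>t k\<close> in the box
  \<open>u < \<rho> * q ^ k\<close>, \<open>v < m * \<rho> * q ^ k\<close>: the hypotheses on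
  \<open>q\<close> say that one flow followed by one jump shrinks the box by \<open>q\<close>. The
  functions carry the index \<open>k\<close> because the weights depend on the mode; the left limit
  at an event is measured with the old weights, the new state with the new ones.\<close>

lemma hybrid_decay:
  fixes u v :: "nat \<Rightarrow> real \<Rightarrow> real"
  assumes t: "event_times t" and dwell: "\<And>k. T \<le> t (Suc k) - t k"
    and du: "\<And>k s. s \<in> {t k..<t (Suc k)} \<Longrightarrow>
      \<exists>f. ((\<lambda>s. (u k s)\<^sup>2) has_real_derivative f) (at s within {t k..<t (Suc k)}) \<and>
        f \<le> 2 * u k s * (- l * u k s + C * v k s)"
    and dv: "\<And>k s. s \<in> {t k..<t (Suc k)} \<Longrightarrow>
      \<exists>g. ((\<lambda>s. (v k s)\<^sup>2) has_real_derivative g) (at s within {t k..<t (Suc k)}) \<and>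
        g \<le> 2 * v k s * (- \<mu> * v k s + C * u k s)"
    and jump: "\<And>k. \<exists>ul vl. (u k \<longlongrightarrow> ul) (at_left (t (Suc k))) \<and> (v k \<longlongrightarrow> vl) (at_left (t (Suc k))) \<and>
        u (Suc k) (t (Suc k)) \<le> ul + C * vl \<and> v (Suc k) (t (Suc k)) \<le> C * ul + C * vl"
    and nonneg: "\<And>k s. u k s \<ge> 0" "\<And>k s. v k s \<ge> 0"
    and pos: "C > 0" "l > 0" "\<mu> > l" "\<kappa> > 0" "\<rho> > 0" "m > 0" "T \<ge> 0"
    and \<kappa>: "C * \<kappa> \<le> l / 2" "(\<mu> - l) * \<kappa> > C"
    and q: "0 < q" "exp (- (l/2) * T) * (1 + \<kappa> * m) * (1 + C * \<kappa>) + C * m * exp (- \<mu> * T) < q"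
      "C * (1 + \<kappa> * m) + C * (m * exp (- \<mu> * T) + \<kappa> * (1 + \<kappa> * m)) < q * m"
    and init: "u 0 0 < \<rho>" "v 0 0 < m * \<rho>"
    and s: "s \<in> {t k..<t (Suc k)}"
  shows "u k s < (1 + \<kappa> * m) * (\<rho> * q ^ k)" "v k s < (m + \<kappa> * (1 + \<kappa> * m)) * (\<rho> * q ^ k)"
proof -
  define \<alpha> where "\<alpha> = 1 + \<kappa> * m"
  have \<alpha>: "\<alpha> > 0" using pos by (simp add: \<alpha>_def add_pos_pos)
  define e where "e = (\<lambda>h. exp (- (l/2) * h))"
  define F where "F = (\<lambda>h. exp (- \<mu> * h))"
  have eF: "0 < e h" "0 < F h" "e h \<le> e h'" "F h \<le> F h'" if "h' \<le> h" for h h'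
    using that pos by (auto simp: e_def F_def)
  \<comment> \<open>The radius \<open>r\<close> is left free so that \<open>flow_bound\<close> can
    restart at every event.\<close>
  have flow: "u k s < e (s - t k) * \<alpha> * r \<and> v k s < (m * F (s - t k) + \<kappa> * (e (s - t k) * \<alpha>)) * r"
    if "u k (t k) < r" "v k (t k) < m * r" "r > 0" "s \<in> {t k..<t (Suc k)}" for k s r
    unfolding e_def F_def \<alpha>_def using that pos \<kappa>
    by (intro flow_bound[where C = C and l = l and ?t1.0 = "t (Suc k)"] du dv nonneg) auto
  have *: "u k (t k) < \<rho> * q ^ k \<and> v k (t k) < m * (\<rho> * q ^ k)" for k
  proof (induction k)
    case 0
    then show ?case using init t by (simp add: event_times_def)
  next
    case (Suc k)
    define r where "r = \<rho> * q ^ k"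
    have r: "r > 0" using pos q by (simp add: r_def)
    define h where "h = t (Suc k) - t k"
    have lt: "t k < t (Suc k)" using t by (simp add: event_times_def strict_mono_def)
    have h: "T \<le> h" using dwell by (simp add: h_def)
    obtain ul vl where lim: "(u k \<longlongrightarrow> ul) (at_left (t (Suc k)))" "(v k \<longlongrightarrow> vl) (at_left (t (Suc k)))"
      and j: "u (Suc k) (t (Suc k)) \<le> ul + C * vl" "v (Suc k) (t (Suc k)) \<le> C * ul + C * vl"
      using jump by blast
    have ev: "eventually (\<lambda>s. s \<in> {t k..<t (Suc k)}) (at_left (t (Suc k)))"
      using eventually_at_left_real[OF lt] by eventually_elim auto
    \<comment> \<open>The strict flow bounds become weak in the left limit; strictness returns
      through the strict hypotheses on \<open>q\<close>.\<close>
    have "ul \<le> e h * \<alpha> * r"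
    proof (rule tendsto_le[OF _ _ lim(1)])
      show "((\<lambda>s. e (s - t k) * \<alpha> * r) \<longlongrightarrow> e h * \<alpha> * r) (at_left (t (Suc k)))"
        unfolding e_def h_def by (intro tendsto_intros)
      show "\<forall>\<^sub>F s in at_left (t (Suc k)). u k s \<le> e (s - t k) * \<alpha> * r"
        using ev by eventually_elim (use flow[of k r] Suc.IH r in \<open>auto simp: r_def intro: less_imp_le\<close>)
    qed simp
    moreover have "vl \<le> (m * F h + \<kappa> * (e h * \<alpha>)) * r"
    proof (rule tendsto_le[OF _ _ lim(2)])
      show "((\<lambda>s. (m * F (s - t k) + \<kappa> * (e (s - t k) * \<alpha>)) * r) \<longlongrightarrow> (m * F h + \<kappa> * (e h * \<alpha>)) * r) (at_left (t (Suc k)))"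
        unfolding e_def F_def h_def by (intro tendsto_intros)
      show "\<forall>\<^sub>F s in at_left (t (Suc k)). v k s \<le> (m * F (s - t k) + \<kappa> * (e (s - t k) * \<alpha>)) * r"
        using ev by eventually_elim (use flow[of k r] Suc.IH r in \<open>auto simp: r_def intro: less_imp_le\<close>)
    qed simp
    ultimately have "ul + C * vl \<le> e h * \<alpha> * r + C * ((m * F h + \<kappa> * (e h * \<alpha>)) * r)"
      "C * ul + C * vl \<le> C * (e h * \<alpha> * r) + C * ((m * F h + \<kappa> * (e h * \<alpha>)) * r)"
      using pos by (intro add_mono mult_left_mono; simp)+
    then have 1: "u (Suc k) (t (Suc k)) \<le> (e h * \<alpha> * (1 + C * \<kappa>) + C * m * F h) * r"
      "v (Suc k) (t (Suc k)) \<le> (C * (e h * \<alpha>) + C * (m * F h + \<kappa> * (e h * \<alpha>))) * r"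
      using j by (simp_all add: algebra_simps)
    \<comment> \<open>The slow decay over \<open>T\<close> is kept for the \<open>u\<close> bound,
      whereas the \<open>v\<close> bound works with \<open>e h \<le> 1\<close>, matching the form of
      its hypothesis on \<open>q\<close>.\<close>
    have "e h * \<alpha> \<le> e T * \<alpha>" "e h * \<alpha> \<le> \<alpha>" "m * F h \<le> m * F T"
      using eF(3)[OF h] eF(3)[of 0 h] eF(4)[OF h] h pos \<alpha> by (auto simp: e_def)
    then have "e h * \<alpha> * (1 + C * \<kappa>) \<le> e T * \<alpha> * (1 + C * \<kappa>)" "C * (m * F h) \<le> C * (m * F T)"
      "C * (e h * \<alpha>) \<le> C * \<alpha>" "C * (m * F h + \<kappa> * (e h * \<alpha>)) \<le> C * (m * F T + \<kappa> * \<alpha>)"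
      using pos by (simp_all add: add_mono mult_right_mono)
    then have "e h * \<alpha> * (1 + C * \<kappa>) + C * m * F h < q"
      "C * (e h * \<alpha>) + C * (m * F h + \<kappa> * (e h * \<alpha>)) < q * m"
      using q by (auto simp: e_def F_def \<alpha>_def mult.assoc)
    then have "u (Suc k) (t (Suc k)) < q * r" "v (Suc k) (t (Suc k)) < q * m * r"
      using 1 r by (meson mult_strict_right_mono order_le_less_trans)+
    then show ?case by (simp add: r_def mult_ac)
  qed
  have r: "\<rho> * q ^ k > 0" using pos q by simp
  \<comment> \<open>Between events, bounding both exponentials by \<open>1\<close> gives constants
    independent of the elapsed time.\<close>
  have "e (s - t k) * \<alpha> \<le> 1 * \<alpha>" "m * F (s - t k) \<le> m * 1"
    using s eF[of 0 "s - t k"] pos \<alpha> by (auto simp: e_def F_def)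
  then have "e (s - t k) * \<alpha> * (\<rho> * q ^ k) \<le> \<alpha> * (\<rho> * q ^ k)"
    "(m * F (s - t k) + \<kappa> * (e (s - t k) * \<alpha>)) * (\<rho> * q ^ k) \<le> (m + \<kappa> * \<alpha>) * (\<rho> * q ^ k)"
    using r pos by (intro mult_right_mono add_mono mult_left_mono; simp)+
  then show "u k s < (1 + \<kappa> * m) * (\<rho> * q ^ k)" "v k s < (m + \<kappa> * (1 + \<kappa> * m)) * (\<rho> * q ^ k)"
    using flow[of k "\<rho> * q ^ k" s] * r s by (force simp: \<alpha>_def)+
qed

subsection \<open>Weighted norms and square roots of matrices\<close>

lemma symmetric_matrix_inner:
  fixes M :: "real^'n^'n"
  assumes "symmetric_matrix M"
  shows "x \<bullet> (M *v y) = (M *v x) \<bullet> y"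
  using assms dot_lmul_matrix[of x M y] by (metis symmetric_matrix_def transpose_matrix_vector)

text \<open>The equation says that \<open>I - X\<close> is a square root of \<open>I - B\<close>.\<close>

lemma blinfun_sqrt_one_minus:
  fixes B :: "'a::euclidean_space \<Rightarrow>\<^sub>L 'a"
  assumes B: "norm B < 1" and sym: "\<And>x y. x \<bullet> B y = B x \<bullet> y"
  shows "\<exists>X. norm X < 1 \<and> (\<forall>x y. x \<bullet> blinfun_apply X y = X x \<bullet> y) \<and> 2 *\<^sub>R X = B + (X o\<^sub>L X)"
proof -
  \<comment> \<open>\<open>r\<close> is the smaller root of
    \<open>r * r - 2 * r + norm B = 0\<close>, so the map \<open>T\<close> below sends the ball of
    radius \<open>r\<close> into itself, with Lipschitz constant \<open>r < 1\<close>.\<close>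
  define r where "r = 1 - sqrt (1 - norm B)"
  have r: "0 \<le> r" "r < 1" using B by (auto simp: r_def)
  have r2: "norm B + r * r = 2 * r"
    using B by (simp add: r_def algebra_simps)
  define T where "T = (\<lambda>X :: 'a \<Rightarrow>\<^sub>L 'a. (1/2) *\<^sub>R (B + (X o\<^sub>L X)))"
  \<comment> \<open>Self-adjointness is a closed condition preserved by \<open>T\<close>; building
    it into \<open>S\<close> passes it on to the fixed point.\<close>
  define S where "S = cball (0 :: 'a \<Rightarrow>\<^sub>L 'a) r \<inter> {X. \<forall>x y. x \<bullet> blinfun_apply X y = X x \<bullet> y}"
  have clS: "closed {X :: 'a \<Rightarrow>\<^sub>L 'a. \<forall>x y. x \<bullet> blinfun_apply X y = X x \<bullet> y}"
    by (intro closed_Collect_all closed_Collect_eq continuous_intros)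
  have "\<exists>!X. X \<in> S \<and> T X = X"
  proof (rule Banach_fix[where c = r])
    show "complete S" unfolding S_def using clS
      by (intro closed_Int closed_cball complete_eq_closed[THEN iffD2])
    have "0 \<in> S" using r by (simp add: S_def)
    then show "S \<noteq> {}" by blast
    show "T ` S \<subseteq> S"
    proof safe
      fix X assume X: "X \<in> S"
      have "norm (X o\<^sub>L X) \<le> r * r"
        using norm_blinfun_compose[of X X] mult_mono[of "norm X" r "norm X" r] X r by (auto simp: S_def)
      then have "norm (B + (X o\<^sub>L X)) \<le> 2 * r" using norm_triangle_ineq[of B "X o\<^sub>L X"] r2 by linarith
      then have "norm (T X) \<le> r" by (simp add: T_def)
      moreover have "x \<bullet> T X y = T X x \<bullet> y" for x y
        using X sym by (simp add: T_def S_def blinfun.bilinear_simps inner_simps)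
      ultimately show "T X \<in> S" by (simp add: S_def)
    qed
    show "dist (T X) (T Y) \<le> r * dist X Y" if "X \<in> S" "Y \<in> S" for X Y
    proof -
      \<comment> \<open>Telescoping through the product of \<open>X\<close> and \<open>Y\<close>
        splits the difference of squares even when they do not commute.\<close>
      have "T X - T Y = (1/2) *\<^sub>R ((X o\<^sub>L (X - Y)) + ((X - Y) o\<^sub>L Y))"
        by (rule blinfun_eqI) (simp add: T_def blinfun.bilinear_simps algebra_simps)
      moreover have "norm (X o\<^sub>L (X - Y)) \<le> r * norm (X - Y)" "norm ((X - Y) o\<^sub>L Y) \<le> norm (X - Y) * r"
        using that norm_blinfun_compose[of X "X - Y"] norm_blinfun_compose[of "X - Y" Y]
          mult_right_mono[of "norm X" r "norm (X - Y)"] mult_left_mono[of "norm Y" r "norm (X - Y)"]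
        by (auto simp: S_def)
      ultimately show ?thesis
        using norm_triangle_ineq[of "X o\<^sub>L (X - Y)" "(X - Y) o\<^sub>L Y"] by (simp add: dist_norm mult.commute)
    qed
  qed (use r in auto)
  then obtain X where X: "X \<in> S" "T X = X" by blast
  have "2 *\<^sub>R T X = B + (X o\<^sub>L X)" by (simp add: T_def)
  then have "2 *\<^sub>R X = B + (X o\<^sub>L X)" by (simp add: X(2))
  with X(1) r show ?thesis by (intro exI[of _ X]) (auto simp: S_def)
qed

text \<open>\<open>matrix_sqrt\<close> is a choice, so one symmetric positive semidefinite root has
  to be exhibited. It is \<open>sqrt c\<close> times \<open>I - X\<close>, with \<open>X\<close>
  from the fixed-point lemma applied to \<open>I - Q/c\<close>.\<close>

lemma matrix_sqrt_properties:
  fixes Q :: "real^'n^'n"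
  assumes sym: "symmetric_matrix Q" and ge: "loewner_le (mat 1) Q"
  shows "symmetric_matrix (matrix_sqrt Q)" "matrix_sqrt Q ** matrix_sqrt Q = Q"
proof -
  have ge': "x \<bullet> x \<le> x \<bullet> (Q *v x)" for x
    using ge by (simp add: loewner_le_def matrix_vector_mult_diff_rdistrib inner_diff_right)
  define q where "q = Blinfun ((*v) Q)"
  have q: "blinfun_apply q = (*v) Q"
    unfolding q_def by (intro bounded_linear_Blinfun_apply matrix_vector_mul_bounded_linear)
  \<comment> \<open>With this scaling, \<open>Q \<ge> I\<close> makes \<open>I - Q/c\<close> a strict contraction.\<close>
  define c where "c = (norm q)\<^sup>2"
  have "1 \<le> norm q"
  proof -
    obtain x :: "real^'n" where x: "norm x = 1" using vector_choose_size[of 1] by auto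
    have "1 \<le> x \<bullet> (Q *v x)" using ge'[of x] x by (simp add: dot_square_norm)
    also have "\<dots> \<le> norm x * norm (q x)" by (simp add: q norm_cauchy_schwarz)
    also have "\<dots> \<le> norm q" using norm_blinfun[of q x] x by simp
    finally show ?thesis .
  qed
  then have c: "c \<ge> 1" by (simp add: c_def)
  define B where "B = id_blinfun - (1/c) *\<^sub>R q"
  have Bx: "B x = x - (1/c) *\<^sub>R (Q *v x)" for x by (simp add: B_def q blinfun.bilinear_simps)
  have "norm (B x) \<le> sqrt (1 - 1/c) * norm x" for x
  proof (rule power2_le_imp_le)
    have "(x - r *\<^sub>R y) \<bullet> (x - r *\<^sub>R y) = x \<bullet> x - 2 * r * (x \<bullet> y) + r\<^sup>2 * (y \<bullet> y)" for r and y :: "real^'n"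
      by (simp add: inner_diff_left inner_diff_right inner_commute[of y x] power2_eq_square algebra_simps)
    \<comment> \<open>\<open>Q \<ge> I\<close> bounds the cross term by \<open>- 2/c\<close> and the
      operator norm bounds the last term by \<open>1/c\<close>, both times
      \<open>x \<bullet> x\<close>.\<close>
    from this[of "1/c" "Q *v x"] have "(norm (B x))\<^sup>2 = x \<bullet> x - 2 / c * (x \<bullet> (Q *v x)) + (norm (Q *v x))\<^sup>2 / c\<^sup>2"
      unfolding power2_norm_eq_inner Bx by (simp add: power_divide)
    also have "\<dots> \<le> x \<bullet> x - 2 / c * (x \<bullet> x) + c * (x \<bullet> x) / c\<^sup>2"
    proof (intro add_mono diff_left_mono mult_left_mono divide_right_mono ge')
      have "norm (Q *v x) \<le> norm q * norm x" using norm_blinfun[of q x] by (simp add: q)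
      then have "(norm (Q *v x))\<^sup>2 \<le> (norm q * norm x)\<^sup>2" by (intro power_mono) auto
      then show "(norm (Q *v x))\<^sup>2 \<le> c * (x \<bullet> x)"
        by (simp add: c_def power_mult_distrib power2_norm_eq_inner)
    qed (use c in auto)
    also have "\<dots> = (1 - 1/c) * (x \<bullet> x)" using c by (simp add: field_simps power2_eq_square)
    also have "\<dots> = (sqrt (1 - 1/c) * norm x)\<^sup>2" using c by (simp add: power_mult_distrib power2_norm_eq_inner)
    finally show "(norm (B x))\<^sup>2 \<le> (sqrt (1 - 1/c) * norm x)\<^sup>2" .
  qed (use c in auto)
  then have "norm B \<le> sqrt (1 - 1/c)" using c by (intro norm_blinfun_bound) auto
  also have "\<dots> < 1" using c by simp
  finally have nB: "norm B < 1" .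
  have "x \<bullet> B y = B x \<bullet> y" for x y
    using symmetric_matrix_inner[OF sym, of x y] by (simp add: Bx inner_simps)
  then obtain X where X: "norm X < 1" "\<And>x y. x \<bullet> blinfun_apply X y = X x \<bullet> y" "2 *\<^sub>R X = B + (X o\<^sub>L X)"
    using blinfun_sqrt_one_minus[OF nB] by blast
  define Y where "Y = sqrt c *\<^sub>R (id_blinfun - X)"
  define M where "M = matrix (blinfun_apply Y)"
  have M: "M *v x = Y x" for x
    unfolding M_def using fun_cong[OF matrix_vector_mul(3)[OF blinfun.bounded_linear_right[of Y]], of x] .
  have "Y (Y x) = Q *v x" for x
  proof -
    have "2 *\<^sub>R X x = B x + X (X x)" using arg_cong[OF X(3), of "\<lambda>Z. blinfun_apply Z x"] by (simp add: blinfun.bilinear_simps)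
    then have "x - X x - (X x - X (X x)) = (1/c) *\<^sub>R (Q *v x)" by (simp add: Bx scaleR_2 algebra_simps)
    moreover have "Y (Y x) = (sqrt c * sqrt c) *\<^sub>R (x - X x - (X x - X (X x)))"
      by (simp add: Y_def blinfun.bilinear_simps scaleR_right_distrib scaleR_right_diff_distrib del: real_sqrt_mult_self)
    ultimately show ?thesis using c by simp
  qed
  then have "(M ** M) *v x = Q *v x" for x by (simp add: M flip: matrix_vector_mul_assoc)
  then have 1: "M ** M = Q" by (simp add: matrix_eq)
  have "x \<bullet> (M *v y) = (M *v x) \<bullet> y" for x y
    by (simp add: M Y_def blinfun.bilinear_simps inner_simps X(2))
  then have "(M *v x) \<bullet> y = (transpose M *v x) \<bullet> y" for x y
    by (metis dot_lmul_matrix transpose_matrix_vector)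
  then have "transpose M = M" by (metis matrix_eq vector_eq_rdot)
  then have 2: "symmetric_matrix M" by (simp add: symmetric_matrix_def)
  \<comment> \<open>\<open>norm X < 1\<close> makes \<open>I - X\<close> positive
    semidefinite.\<close>
  have "0 \<le> x \<bullet> (M *v x)" for x
  proof -
    have "x \<bullet> X x \<le> norm x * norm (X x)" by (rule norm_cauchy_schwarz)
    also have "\<dots> \<le> norm x * (1 * norm x)"
      using norm_blinfun[of X x] X(1) mult_right_mono[of "norm X" 1 "norm x"] by (intro mult_left_mono) auto
    finally show ?thesis using c by (simp add: M Y_def blinfun.bilinear_simps inner_simps dot_square_norm power2_eq_square)
  qed
  then have 3: "loewner_le 0 M" by (simp add: loewner_le_def)
  have "symmetric_matrix (matrix_sqrt Q) \<and> loewner_le 0 (matrix_sqrt Q) \<and> matrix_sqrt Q ** matrix_sqrt Q = Q"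
    unfolding matrix_sqrt_def by (rule someI[of _ M]) (use 1 2 3 in auto)
  then show "symmetric_matrix (matrix_sqrt Q)" "matrix_sqrt Q ** matrix_sqrt Q = Q" by auto
qed

text \<open>Moving one root across the inner product gives the identity. Domination of the Euclidean
  norm follows from \<open>Q \<ge> I\<close> and forces a trivial kernel, hence
  invertibility.\<close>

lemma norm_matrix_sqrt:
  fixes Q :: "real^'n^'n"
  assumes "symmetric_matrix Q" "loewner_le (mat 1) Q"
  shows "(norm (matrix_sqrt Q *v x))\<^sup>2 = x \<bullet> (Q *v x)" "norm x \<le> norm (matrix_sqrt Q *v x)"
    "invertible (matrix_sqrt Q)"
proof -
  note M = matrix_sqrt_properties[OF assms]
  show 1: "(norm (matrix_sqrt Q *v x))\<^sup>2 = x \<bullet> (Q *v x)" for x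
    using symmetric_matrix_inner[OF M(1), of x "matrix_sqrt Q *v x"] M(2)
    by (metis matrix_vector_mul_assoc power2_norm_eq_inner)
  show 2: "norm x \<le> norm (matrix_sqrt Q *v x)" for x
  proof (rule power2_le_imp_le)
    show "(norm x)\<^sup>2 \<le> (norm (matrix_sqrt Q *v x))\<^sup>2"
      unfolding 1 using assms(2)
      by (simp add: loewner_le_def matrix_vector_mult_diff_rdistrib inner_diff_right dot_square_norm)
  qed simp
  have "inj ((*v) (matrix_sqrt Q))"
  proof (rule injI)
    fix x y assume "matrix_sqrt Q *v x = matrix_sqrt Q *v y"
    then have "matrix_sqrt Q *v (x - y) = 0" by (simp add: matrix_vector_mult_diff_distrib)
    then show "x = y" using 2[of "x - y"] by simp
  qed
  then show "invertible (matrix_sqrt Q)"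
    by (simp add: invertible_left_inverse matrix_left_invertible_injective)
qed

section \<open>Block matrices and uniform bounds over finite index sets\<close>

lemma four_block_apply:
  fixes M :: "real^('nx::finite + 'nz::finite)^('nx + 'nz)"
  shows "M *v join_vec x y = join_vec (blk11 M *v x + blk12 M *v y) (blk21 M *v x + blk22 M *v y)"
proof -
  have *: "(\<Sum>k\<in>UNIV. f k) = (\<Sum>a\<in>UNIV. f (Inl a)) + (\<Sum>b\<in>UNIV. f (Inr b))" for f :: "'nx + 'nz \<Rightarrow> real"
    by (simp add: UNIV_Plus_UNIV[symmetric] sum.Plus del: UNIV_Plus_UNIV)
  show ?thesis
    by (auto simp: vec_eq_iff join_vec_def matrix_vector_mult_def blk11_def blk12_def blk21_def blk22_def * split: sum.split)
qed

lemma join_vec_inject: "join_vec x y = join_vec x' y' \<longleftrightarrow> x = x' \<and> y = y'"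
proof
  assume *: "join_vec x y = join_vec x' y'"
  have "x $ a = x' $ a" for a using arg_cong[OF *, of "\<lambda>z. z $ Inl a"] by (simp add: join_vec_def)
  moreover have "y $ b = y' $ b" for b using arg_cong[OF *, of "\<lambda>z. z $ Inr b"] by (simp add: join_vec_def)
  ultimately show "x = x' \<and> y = y'" by (simp add: vec_eq_iff)
qed simp

text \<open>The sum of the finitely many operator norms dominates each of them, and the added
  \<open>1\<close> secures positivity. The index may be a mode or a triple describing a
  jump.\<close>

lemma uniform_matrix_bound:
  fixes F :: "'k::finite \<Rightarrow> real^'a^'b"
  shows "\<exists>C>0. \<forall>k x. norm (F k *v x) \<le> C * norm x"
proof -
  define C where "C = 1 + (\<Sum>k\<in>UNIV. onorm ((*v) (F k)))"
  have on: "onorm ((*v) (F k)) \<ge> 0" for k by (intro onorm_pos_le matrix_vector_mul_bounded_linear)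
  have "norm (F k *v x) \<le> C * norm x" for k x
  proof -
    have "norm (F k *v x) \<le> onorm ((*v) (F k)) * norm x"
      by (intro onorm matrix_vector_mul_bounded_linear)
    also have "onorm ((*v) (F k)) \<le> C"
      using member_le_sum[of k UNIV "\<lambda>k. onorm ((*v) (F k))"] on by (simp add: C_def)
    finally show ?thesis by (simp add: mult_right_mono)
  qed
  moreover have "C > 0" using on by (simp add: C_def add_pos_nonneg sum_nonneg)
  ultimately show ?thesis by blast
qed

section \<open>Quadratic Lyapunov functions along the flow\<close>

lemma quadratic_form_derivative:
  fixes Q :: "real^'n^'n"
  assumes "symmetric_matrix Q" and x: "(x has_vector_derivative dx) (at s within S)"
  shows "((\<lambda>s. x s \<bullet> (Q *v x s)) has_real_derivative 2 * (x s \<bullet> (Q *v dx))) (at s within S)"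
proof -
  have "((\<lambda>s. x s \<bullet> (Q *v x s)) has_derivative (\<lambda>h. x s \<bullet> (Q *v (h *\<^sub>R dx)) + (h *\<^sub>R dx) \<bullet> (Q *v x s))) (at s within S)"
    using x unfolding has_vector_derivative_def
    by (intro has_derivative_inner bounded_linear.has_derivative[OF matrix_vector_mul_bounded_linear])
  moreover have "(\<lambda>h. x s \<bullet> (Q *v (h *\<^sub>R dx)) + (h *\<^sub>R dx) \<bullet> (Q *v x s)) = (*) (2 * (x s \<bullet> (Q *v dx)))"
    using symmetric_matrix_inner[OF assms(1), of "x s" dx]
    by (simp add: fun_eq_iff matrix_vector_mult_scaleR inner_commute)
  ultimately show ?thesis by (simp add: has_field_derivative_def)
qed

text \<open>Symmetry of \<open>Q\<close> makes the two terms of the Lyapunov expression contribute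
  equally to the quadratic form, which cancels the factor \<open>2\<close>.\<close>

lemma lyapunov_inequality:
  fixes Q A :: "real^'n^'n"
  assumes "symmetric_matrix Q" "loewner_le (transpose A ** Q + Q ** A) ((- 2 * l) *\<^sub>R Q)"
  shows "x \<bullet> (Q *v (A *v x)) \<le> - l * (x \<bullet> (Q *v x))"
proof -
  have "x \<bullet> (((- 2 * l) *\<^sub>R Q) *v x) = - 2 * l * (x \<bullet> (Q *v x))"
    by (simp only: scaleR_matrix_vector_assoc[symmetric] inner_scaleR_right)
  moreover have "0 \<le> x \<bullet> (((- 2 * l) *\<^sub>R Q) *v x) - (x \<bullet> (transpose A *v (Q *v x)) + x \<bullet> (Q *v (A *v x)))"
    using assms(2)[unfolded loewner_le_def, rule_format, of x]
    by (simp del: mult_minus_left add: matrix_vector_mult_diff_rdistrib matrix_vector_mult_add_rdistrib matrix_vector_mul_assoc inner_simps)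
  moreover have "x \<bullet> (transpose A *v (Q *v x)) = (A *v x) \<bullet> (Q *v x)"
    by (metis dot_lmul_matrix inner_commute transpose_matrix_vector)
  moreover have "(A *v x) \<bullet> (Q *v x) = x \<bullet> (Q *v (A *v x))"
    using symmetric_matrix_inner[OF assms(1), of x "A *v x"] by (simp add: inner_commute)
  ultimately show ?thesis by linarith
qed

lemma quadratic_form_Cauchy_Schwarz:
  fixes Q :: "real^'n^'n"
  assumes "symmetric_matrix Q" "loewner_le (mat 1) Q"
  shows "x \<bullet> (Q *v w) \<le> norm (matrix_sqrt Q *v x) * norm (matrix_sqrt Q *v w)"
proof -
  note M = matrix_sqrt_properties[OF assms]
  have "x \<bullet> (Q *v w) = (matrix_sqrt Q *v x) \<bullet> (matrix_sqrt Q *v w)"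
    using symmetric_matrix_inner[OF M(1), of x "matrix_sqrt Q *v w"] M(2)
    by (simp add: matrix_vector_mul_assoc)
  then show ?thesis by (simp add: norm_cauchy_schwarz)
qed

text \<open>Inserting \<open>matrix_inv M ** M\<close> before \<open>x\<close> converts a bound on a
  weighted spectral norm, the form in which \<open>gamma11\<close> is given, into a comparison of
  weighted vector norms.\<close>

lemma spectral_norm_weighted:
  fixes M :: "real^'n^'n" and N :: "real^'n^'k"
  assumes "invertible M" "spectral_norm (N ** matrix_inv M) \<le> c"
  shows "norm (N *v x) \<le> c * norm (M *v x)"
proof -
  have "matrix_inv M ** M = mat 1"
    using someI_ex[OF assms(1)[unfolded invertible_def]] by (simp add: matrix_inv_def)
  then have "N *v x = (N ** matrix_inv M) *v (M *v x)"
    by (simp add: matrix_vector_mul_assoc flip: matrix_mul_assoc)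
  then have "norm (N *v x) \<le> spectral_norm (N ** matrix_inv M) * norm (M *v x)"
    unfolding spectral_norm_def by (simp add: onorm matrix_vector_mul_bounded_linear)
  also have "\<dots> \<le> c * norm (M *v x)" using assms(2) by (intro mult_right_mono) auto
  finally show ?thesis .
qed

text \<open>The Lyapunov inequality handles the drift, and Cauchy-Schwarz in the \<open>Q\<close>
  inner product the perturbation \<open>w\<close>. The slow equation takes \<open>c = 1\<close>, the
  fast one \<open>c = 1 / \<epsilon>\<close>.\<close>

lemma lyapunov_flow_bound:
  fixes Q A :: "real^'n^'n"
  assumes Q: "symmetric_matrix Q" "loewner_le (mat 1) Q"
    and lyap: "loewner_le (transpose A ** Q + Q ** A) ((- 2 * l) *\<^sub>R Q)"
    and x: "(x has_vector_derivative c *\<^sub>R (A *v x s) + w) (at s within S)"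
    and w: "norm (matrix_sqrt Q *v w) \<le> W" and "c \<ge> 0"
  shows "\<exists>f. ((\<lambda>s. (norm (matrix_sqrt Q *v x s))\<^sup>2) has_real_derivative f) (at s within S) \<and>
    f \<le> 2 * norm (matrix_sqrt Q *v x s) * (- (c * l) * norm (matrix_sqrt Q *v x s) + W)"
proof (intro exI conjI)
  show "((\<lambda>s. (norm (matrix_sqrt Q *v x s))\<^sup>2) has_real_derivative
      2 * (x s \<bullet> (Q *v (c *\<^sub>R (A *v x s) + w)))) (at s within S)"
    using quadratic_form_derivative[OF Q(1) x] by (simp only: norm_matrix_sqrt(1)[OF Q])
  define u where "u = norm (matrix_sqrt Q *v x s)"
  have "x s \<bullet> (Q *v w) \<le> u * norm (matrix_sqrt Q *v w)"
    using quadratic_form_Cauchy_Schwarz[OF Q] by (simp add: u_def)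
  also have "\<dots> \<le> u * W" using w by (intro mult_left_mono) (simp_all add: u_def)
  finally have 1: "x s \<bullet> (Q *v w) \<le> u * W" .
  have "c * (x s \<bullet> (Q *v (A *v x s))) \<le> c * (- l * u\<^sup>2)"
    using lyapunov_inequality[OF Q(1) lyap, of "x s"] \<open>c \<ge> 0\<close>
    unfolding u_def norm_matrix_sqrt(1)[OF Q] by (rule mult_left_mono)
  then have "x s \<bullet> (Q *v (c *\<^sub>R (A *v x s) + w)) \<le> c * (- l * u\<^sup>2) + u * W"
    using 1 by (simp add: matrix_vector_right_distrib matrix_vector_mult_scaleR inner_add_right)
  then show "2 * (x s \<bullet> (Q *v (c *\<^sub>R (A *v x s) + w))) \<le>
      2 * norm (matrix_sqrt Q *v x s) * (- (c * l) * norm (matrix_sqrt Q *v x s) + W)"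
    unfolding u_def[symmetric] by (simp add: algebra_simps power2_eq_square)
qed

subsection \<open>Stability of the hybrid system\<close>

theorem theorem9:
  fixes Z :: "'i::finite \<Rightarrow> ('nx::finite + 'nz::finite) set"
    and S bA A :: "'i \<Rightarrow> real^('nx + 'nz)^('nx + 'nz)"
    and bJ :: "'j::finite \<Rightarrow> real^('nx + 'nz)^('nx + 'nz)"
    and Jm R :: "'i \<Rightarrow> 'j \<Rightarrow> 'i \<Rightarrow> real^('nx + 'nz)^('nx + 'nz)"
    and Qs :: "'i \<Rightarrow> real^'nx^'nx" and Qf :: "'i \<Rightarrow> real^'nz^'nz"
    and ls lf :: "'i \<Rightarrow> real" and lambda_f gamma11 gamma12 :: real
  assumes "\<And>i. card (Z i) = CARD('nz)"
    and "\<And>i. permutation_matrix (S i)"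
    and "\<And>i \<epsilon>. \<epsilon> > 0 \<Longrightarrow>
          S i ** scaling_matrix (Z i) \<epsilon> ** transpose (S i) = four_blocks (mat 1) 0 0 (mat \<epsilon>)"
    and "\<And>i. A i = S i ** bA i ** transpose (S i)"
    and "\<And>i j i'. Jm i j i' = S i' ** bJ j ** transpose (S i)"
    and "\<And>i. invertible (blk22 (A i))"
    and "\<And>i j i'. R i j i' = mat_P (A i') ** Jm i j i' ** matrix_inv (mat_P (A i))"
    and "\<And>i. hurwitz (mat_A0 (A i))"
    and "\<And>i. hurwitz (blk22 (A i))"
    and "\<And>i. symmetric_matrix (Qs i)" and "\<And>i. loewner_le (mat 1) (Qs i)"
    and "\<And>i. symmetric_matrix (Qf i)" and "\<And>i. loewner_le (mat 1) (Qf i)"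
    and "\<And>i. ls i > 0" and "\<And>i. lf i > 0"
    and "\<And>i. loewner_le (transpose (mat_A0 (A i)) ** Qs i + Qs i ** mat_A0 (A i))
                ((- 2 * ls i) *\<^sub>R Qs i)"
    and "\<And>i. loewner_le (transpose (blk22 (A i)) ** Qf i + Qf i ** blk22 (A i))
                ((- 2 * lf i) *\<^sub>R Qf i)"
    and "lambda_f = Min (range lf)"
    and "gamma11 = Max (range (\<lambda>(i, j, i'). spectral_norm
          (matrix_sqrt (Qs i') ** blk11 (R i j i') ** matrix_inv (matrix_sqrt (Qs i)))))"
    and "gamma12 = Max (range (\<lambda>(i, j, i'). spectral_norm
          (matrix_sqrt (Qs i') ** blk12 (R i j i') ** matrix_inv (matrix_sqrt (Qf i)))))"
    and "gamma11 = 1" and "gamma12 \<noteq> 0"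
  shows "\<exists>\<epsilon>2>0. \<exists>\<eta>2 :: real \<Rightarrow> real.
    (\<forall>\<epsilon>\<in>{0<..<\<epsilon>2}. \<eta>2 \<epsilon> \<ge> 0) \<and> O_eps \<epsilon>2 \<eta>2 \<and>
    (\<forall>\<epsilon>\<in>{0<..<\<epsilon>2}. \<forall>t. event_times t \<longrightarrow>
      (\<exists>\<tau>. \<tau> > - \<epsilon> / lambda_f * ln \<epsilon> + \<eta>2 \<epsilon> \<and> (\<forall>k. t (Suc k) - t k \<ge> \<tau>)) \<longrightarrow>
      (\<forall>(\<sigma> :: nat \<Rightarrow> 'i) (\<nu> :: nat \<Rightarrow> 'j).
        globally_asymptotically_stable
          {z :: real \<Rightarrow> (real^'nx) \<times> (real^'nz).
            solution_H A R \<epsilon> t \<sigma> \<nu> (\<lambda>s. fst (z s)) (\<lambda>s. snd (z s))}))"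
proof -

  \<comment> \<open>Weights, rates and constants common to all modes\<close>
  define Ms where "Ms = (\<lambda>i. matrix_sqrt (Qs i))"
  define Mf where "Mf = (\<lambda>i. matrix_sqrt (Qf i))"
  note Qs = assms(10,11) and Qf = assms(12,13)
  have le_Ms: "norm x \<le> norm (Ms i *v x)" for i x
    unfolding Ms_def by (rule norm_matrix_sqrt(2)[OF Qs])
  have le_Mf: "norm y \<le> norm (Mf i *v y)" for i y
    unfolding Mf_def by (rule norm_matrix_sqrt(2)[OF Qf])
  define l where "l = Min (range ls)"
  have l: "l > 0" "l \<le> ls i" for i using assms(14) by (auto simp: l_def)
  have L: "lambda_f > 0" "lambda_f \<le> lf i" for i using assms(15,18) by auto
  \<comment> \<open>Here \<open>gamma11 = 1\<close> enters: the slow-to-slow block does not expand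
    from the old weighted norm to the new one.\<close>
  have R11: "norm (Ms i' *v (blk11 (R i j i') *v x)) \<le> norm (Ms i *v x)" for i j i' x
  proof -
    have "spectral_norm (Ms i' ** blk11 (R i j i') ** matrix_inv (Ms i)) \<le> gamma11"
      unfolding assms(19) Ms_def by (rule Max_ge) (auto intro!: image_eqI[of _ _ "(i, j, i')"])
    then show ?thesis
      using spectral_norm_weighted[of "Ms i" "Ms i' ** blk11 (R i j i')" 1 x]
        norm_matrix_sqrt(3)[OF Qs] assms(21)
      by (simp add: matrix_vector_mul_assoc Ms_def)
  qed
  \<comment> \<open>\<open>C1\<close> to \<open>C3\<close> bound the flow couplings,
    \<open>C4\<close> to \<open>C6\<close> the remaining jump blocks; \<open>Ns\<close> and
    \<open>Nf\<close> compare weighted and Euclidean norms of the initial state.\<close>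
  obtain C1 where C1: "C1 > 0" "\<And>i y. norm (Ms i *v (mat_B1 (A i) *v y)) \<le> C1 * norm y"
    using uniform_matrix_bound[of "\<lambda>i. Ms i ** mat_B1 (A i)"] by (auto simp: matrix_vector_mul_assoc)
  obtain C2 where C2: "C2 > 0" "\<And>i x. norm (Mf i *v (mat_B2 (A i) *v x)) \<le> C2 * norm x"
    using uniform_matrix_bound[of "\<lambda>i. Mf i ** mat_B2 (A i)"] by (auto simp: matrix_vector_mul_assoc)
  obtain C3 where C3: "C3 > 0" "\<And>i y. norm (Mf i *v (mat_B3 (A i) *v y)) \<le> C3 * norm y"
    using uniform_matrix_bound[of "\<lambda>i. Mf i ** mat_B3 (A i)"] by (auto simp: matrix_vector_mul_assoc)
  obtain C4 where C4: "C4 > 0" "\<And>i j i' y. norm (Ms i' *v (blk12 (R i j i') *v y)) \<le> C4 * norm y"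
    using uniform_matrix_bound[of "\<lambda>(i, j, i'). Ms i' ** blk12 (R i j i')"] by (auto simp: matrix_vector_mul_assoc)
  obtain C5 where C5: "C5 > 0" "\<And>i j i' x. norm (Mf i' *v (blk21 (R i j i') *v x)) \<le> C5 * norm x"
    using uniform_matrix_bound[of "\<lambda>(i, j, i'). Mf i' ** blk21 (R i j i')"] by (auto simp: matrix_vector_mul_assoc)
  obtain C6 where C6: "C6 > 0" "\<And>i j i' y. norm (Mf i' *v (blk22 (R i j i') *v y)) \<le> C6 * norm y"
    using uniform_matrix_bound[of "\<lambda>(i, j, i'). Mf i' ** blk22 (R i j i')"] by (auto simp: matrix_vector_mul_assoc)
  obtain Ns where Ns: "Ns > 0" "\<And>i x. norm (Ms i *v x) \<le> Ns * norm x"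
    using uniform_matrix_bound[of Ms] by blast
  obtain Nf where Nf: "Nf > 0" "\<And>i y. norm (Mf i *v y) \<le> Nf * norm y"
    using uniform_matrix_bound[of Mf] by blast
  define C where "C = C1 + C2 + C3 + C4 + C5 + C6"
  have C: "C > 0" "C1 \<le> C" "C2 \<le> C" "C3 \<le> C" "C4 \<le> C" "C5 \<le> C" "C6 \<le> C"
    using C1(1) C2(1) C3(1) C4(1) C5(1) C6(1) by (auto simp: C_def)
  \<comment> \<open>Since weighted norms dominate the Euclidean one, each of the six bounds can be
    restated with \<open>C\<close> and the weighted norm of any mode.\<close>
  have weaken: "norm z \<le> C * n'" if "norm z \<le> c * n" "c \<le> C" "n \<le> n'" "0 \<le> n"
    for z :: "real^'b" and c n n'
  proof -
    have "c * n \<le> C * n" using that by (intro mult_right_mono)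
    also have "\<dots> \<le> C * n'" using that C by (intro mult_left_mono) auto
    finally show ?thesis using that(1) by linarith
  qed
  note bd = weaken[OF C1(2) C(2) le_Mf norm_ge_zero] weaken[OF C2(2) C(3) le_Ms norm_ge_zero]
    weaken[OF C3(2) C(4) le_Mf norm_ge_zero] weaken[OF C4(2) C(5) le_Mf norm_ge_zero]
    weaken[OF C5(2) C(6) le_Ms norm_ge_zero] weaken[OF C6(2) C(7) le_Mf norm_ge_zero]
  \<comment> \<open>\<open>\<epsilon>2\<close> depends on \<open>C\<close>, \<open>lambda_f\<close>
    and \<open>l\<close> alone, hence is uniform over event times and mode sequences.\<close>
  obtain \<epsilon>2 where \<epsilon>2: "\<epsilon>2 > 0" and small: "\<And>\<epsilon>. 0 < \<epsilon> \<Longrightarrow> \<epsilon> < \<epsilon>2 \<Longrightarrow>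
    (let \<kappa> = 2 * (C + 1) / lambda_f * \<epsilon>; m = 2 * C + 1; \<mu> = lambda_f / \<epsilon> - C; T = - \<epsilon> / lambda_f * ln \<epsilon>
     in \<mu> > l \<and> C * \<kappa> \<le> l / 2 \<and> (\<mu> - l) * \<kappa> > C \<and> T \<ge> 0 \<and>
        exp (- (l/2) * T) * (1 + \<kappa> * m) * (1 + C * \<kappa>) + C * m * exp (- \<mu> * T) < 1 \<and>
        C * (1 + \<kappa> * m) + C * (m * exp (- \<mu> * T) + \<kappa> * (1 + \<kappa> * m)) < m)"
    using small_parameter[OF C(1) L(1) l(1)] by blast

  \<comment> \<open>Stability for a fixed small \<open>\<epsilon>\<close>\<close>
  have gas: "globally_asymptotically_stable
          {z :: real \<Rightarrow> (real^'nx) \<times> (real^'nz).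
            solution_H A R \<epsilon> t \<sigma> \<nu> (\<lambda>s. fst (z s)) (\<lambda>s. snd (z s))}"
    if \<epsilon>: "0 < \<epsilon>" "\<epsilon> < \<epsilon>2" and t: "event_times t"
      and dwell: "\<And>k. - \<epsilon> / lambda_f * ln \<epsilon> \<le> t (Suc k) - t k"
    for \<epsilon> t and \<sigma> :: "nat \<Rightarrow> 'i" and \<nu> :: "nat \<Rightarrow> 'j"
  proof -
    define \<kappa> where "\<kappa> = 2 * (C + 1) / lambda_f * \<epsilon>"
    define m where "m = 2 * C + 1"
    define \<mu> where "\<mu> = lambda_f / \<epsilon> - C"
    define T where "T = - \<epsilon> / lambda_f * ln \<epsilon>"
    have sm: "\<mu> > l" "C * \<kappa> \<le> l / 2" "(\<mu> - l) * \<kappa> > C" "T \<ge> 0"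
      "exp (- (l/2) * T) * (1 + \<kappa> * m) * (1 + C * \<kappa>) + C * m * exp (- \<mu> * T) < 1"
      "C * (1 + \<kappa> * m) + C * (m * exp (- \<mu> * T) + \<kappa> * (1 + \<kappa> * m)) < m"
      using small[OF \<epsilon>] by (simp_all only: Let_def \<kappa>_def m_def \<mu>_def T_def)
    have pos: "\<kappa> > 0" "m \<ge> 1" using C L \<epsilon> by (simp_all add: \<kappa>_def m_def)
    define a where "a = exp (- (l/2) * T) * (1 + \<kappa> * m) * (1 + C * \<kappa>) + C * m * exp (- \<mu> * T)"
    define b where "b = C * (1 + \<kappa> * m) + C * (m * exp (- \<mu> * T) + \<kappa> * (1 + \<kappa> * m))"
    \<comment> \<open>Dividing the fast bound by \<open>m\<close> lets a single \<open>q\<close>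
      serve both components; the maximum with \<open>0\<close> makes \<open>q\<close>
      positive.\<close>
    have "max (max a (b / m)) 0 < 1" using sm pos by (simp add: a_def b_def)
    then obtain q where "max (max a (b / m)) 0 < q" "q < 1" using dense by blast
    then have q: "0 < q" "q < 1" "a < q" "b < q * m" using pos by (auto simp: field_simps)
    \<comment> \<open>\<open>D\<close> adds the prefactors of the \<open>u\<close> and
      \<open>v\<close> bounds in \<open>hybrid_decay\<close>; \<open>N\<close> below converts
      \<open>norm (z 0)\<close> into bounds on the initial weighted norms.\<close>
    define D where "D = 1 + \<kappa> * m + (m + \<kappa> * (1 + \<kappa> * m))"
    have D: "D > 0" unfolding D_def using pos by (intro add_pos_pos mult_pos_pos) auto
    define N where "N = Ns + Nf"
    have N: "N > 0" using Ns Nf by (simp add: N_def)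
    \<comment> \<open>\<open>\<rho>\<close> stays free: stability takes the target radius divided by
      \<open>D\<close>, attraction a value exceeding \<open>N * norm (z 0)\<close>.\<close>
    have decay: "norm (z s) < D * (\<rho> * q ^ k)"
      if sol: "solution_H A R \<epsilon> t \<sigma> \<nu> (\<lambda>s. fst (z s)) (\<lambda>s. snd (z s))"
        and init: "N * norm (z 0) < \<rho>" and s: "s \<in> {t k..<t (Suc k)}" for z \<rho> k s
    proof -
      define x where "x = (\<lambda>s. fst (z s))"
      define y where "y = (\<lambda>s. snd (z s))"
      define u where "u = (\<lambda>k s. norm (Ms (\<sigma> k) *v x s))"
      define v where "v = (\<lambda>k s. norm (Mf (\<sigma> k) *v y s))"
      have "solution_H A R \<epsilon> t \<sigma> \<nu> x y" using sol by (simp add: x_def y_def)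
      note sol = this[unfolded solution_H_def]

      \<comment> \<open>Differential inequalities for the weighted norms\<close>
      have du: "\<exists>f. ((\<lambda>s. (u k s)\<^sup>2) has_real_derivative f) (at s within {t k..<t (Suc k)}) \<and>
          f \<le> 2 * u k s * (- l * u k s + C * v k s)"
        and dv: "\<exists>g. ((\<lambda>s. (v k s)\<^sup>2) has_real_derivative g) (at s within {t k..<t (Suc k)}) \<and>
          g \<le> 2 * v k s * (- \<mu> * v k s + C * u k s)"
        if s: "s \<in> {t k..<t (Suc k)}" for k s
      proof -
        let ?i = "\<sigma> k"
        obtain dx dy where dx: "(x has_vector_derivative dx) (at s within {t k..<t (Suc k)})"
            "dx = mat_A0 (A ?i) *v x s + mat_B1 (A ?i) *v y s"
          and dy: "(y has_vector_derivative dy) (at s within {t k..<t (Suc k)})"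
            "\<epsilon> *\<^sub>R dy = \<epsilon> *\<^sub>R (mat_B2 (A ?i) *v x s) + (blk22 (A ?i) + \<epsilon> *\<^sub>R mat_B3 (A ?i)) *v y s"
          using bspec[OF spec[OF conjunct1[OF sol], of k] s] by (elim exE conjE) (rule that)
        have dx': "dx = 1 *\<^sub>R (mat_A0 (A ?i) *v x s) + mat_B1 (A ?i) *v y s" using dx by simp
        have "\<exists>f. ((\<lambda>s. (u k s)\<^sup>2) has_real_derivative f) (at s within {t k..<t (Suc k)}) \<and>
            f \<le> 2 * u k s * (- (1 * ls ?i) * u k s + C * v k s)"
          unfolding u_def v_def Ms_def
          by (rule lyapunov_flow_bound[OF Qs assms(16) dx(1)[unfolded dx']])
             (use bd(1) in \<open>simp_all add: Ms_def\<close>)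
        moreover have "2 * u k s * (- (1 * ls ?i) * u k s + C * v k s) \<le> 2 * u k s * (- l * u k s + C * v k s)"
          using l(2)[of ?i] by (intro mult_left_mono add_right_mono mult_right_mono) (auto simp: u_def)
        ultimately show "\<exists>f. ((\<lambda>s. (u k s)\<^sup>2) has_real_derivative f) (at s within {t k..<t (Suc k)}) \<and>
            f \<le> 2 * u k s * (- l * u k s + C * v k s)"
          by (meson order_trans)
        \<comment> \<open>After division by \<open>\<epsilon>\<close> only the \<open>blk22\<close>
          term keeps the factor \<open>1 / \<epsilon>\<close>; the \<open>mat_B2\<close> and
          \<open>mat_B3\<close> terms become a perturbation bounded uniformly in
          \<open>\<epsilon>\<close>.\<close>
        have "dy = (1 / \<epsilon>) *\<^sub>R (\<epsilon> *\<^sub>R dy)" using \<epsilon> by simp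
        also have "\<dots> = (1 / \<epsilon>) *\<^sub>R (blk22 (A ?i) *v y s) + (mat_B2 (A ?i) *v x s + mat_B3 (A ?i) *v y s)"
          unfolding dy(2) using \<epsilon>
          by (simp add: matrix_vector_mult_add_rdistrib scaleR_add_right flip: scaleR_matrix_vector_assoc)
        finally have dy': "dy = (1 / \<epsilon>) *\<^sub>R (blk22 (A ?i) *v y s) + (mat_B2 (A ?i) *v x s + mat_B3 (A ?i) *v y s)" .
        have "norm (Mf ?i *v (mat_B2 (A ?i) *v x s + mat_B3 (A ?i) *v y s)) \<le> C * u k s + C * v k s"
          unfolding matrix_vector_right_distrib u_def v_def
          by (intro norm_triangle_le add_mono bd)
        then have "\<exists>g. ((\<lambda>s. (v k s)\<^sup>2) has_real_derivative g) (at s within {t k..<t (Suc k)}) \<and>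
            g \<le> 2 * v k s * (- (1 / \<epsilon> * lf ?i) * v k s + (C * u k s + C * v k s))"
          unfolding v_def Mf_def
          using \<epsilon> by (intro lyapunov_flow_bound[OF Qf assms(17) dy(1)[unfolded dy']]) auto
        \<comment> \<open>The self-coupling \<open>C * v\<close> is absorbed in the fast rate, which
          accounts for the \<open>- C\<close> in \<open>\<mu>\<close>.\<close>
        moreover have "2 * v k s * (- (1 / \<epsilon> * lf ?i) * v k s + (C * u k s + C * v k s))
            \<le> 2 * v k s * (- \<mu> * v k s + C * u k s)"
        proof (rule mult_left_mono)
          have "lambda_f / \<epsilon> * v k s \<le> lf ?i / \<epsilon> * v k s"
            using L(2)[of ?i] \<epsilon> by (intro mult_right_mono divide_right_mono) (auto simp: v_def)
          then show "- (1 / \<epsilon> * lf ?i) * v k s + (C * u k s + C * v k s) \<le> - \<mu> * v k s + C * u k s"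
            by (simp add: \<mu>_def algebra_simps)
        qed (simp add: v_def)
        ultimately show "\<exists>g. ((\<lambda>s. (v k s)\<^sup>2) has_real_derivative g) (at s within {t k..<t (Suc k)}) \<and>
            g \<le> 2 * v k s * (- \<mu> * v k s + C * u k s)"
          by (meson order_trans)
      qed

      \<comment> \<open>Jump inequalities for the weighted norms\<close>
      have jump: "\<exists>ul vl. (u k \<longlongrightarrow> ul) (at_left (t (Suc k))) \<and> (v k \<longlongrightarrow> vl) (at_left (t (Suc k))) \<and>
          u (Suc k) (t (Suc k)) \<le> ul + C * vl \<and> v (Suc k) (t (Suc k)) \<le> C * ul + C * vl" for k
      proof -
        let ?R = "R (\<sigma> k) (\<nu> (Suc k)) (\<sigma> (Suc k))"
        obtain xl yl where lim: "(x \<longlongrightarrow> xl) (at_left (t (Suc k)))" "(y \<longlongrightarrow> yl) (at_left (t (Suc k)))"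
          and j: "join_vec (x (t (Suc k))) (y (t (Suc k))) = ?R *v join_vec xl yl"
          using spec[OF conjunct2[OF sol], of "Suc k"] by auto
        have xy: "x (t (Suc k)) = blk11 ?R *v xl + blk12 ?R *v yl"
          "y (t (Suc k)) = blk21 ?R *v xl + blk22 ?R *v yl"
          using j by (simp_all add: four_block_apply join_vec_inject)
        have "(u k \<longlongrightarrow> norm (Ms (\<sigma> k) *v xl)) (at_left (t (Suc k)))"
          "(v k \<longlongrightarrow> norm (Mf (\<sigma> k) *v yl)) (at_left (t (Suc k)))"
          unfolding u_def v_def
          by (intro tendsto_norm bounded_linear.tendsto[OF matrix_vector_mul_bounded_linear] lim)+
        moreover have "u (Suc k) (t (Suc k)) \<le> norm (Ms (\<sigma> k) *v xl) + C * norm (Mf (\<sigma> k) *v yl)"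
          unfolding u_def xy matrix_vector_right_distrib by (intro norm_triangle_le add_mono bd R11)
        moreover have "v (Suc k) (t (Suc k)) \<le> C * norm (Ms (\<sigma> k) *v xl) + C * norm (Mf (\<sigma> k) *v yl)"
          unfolding v_def xy matrix_vector_right_distrib by (intro norm_triangle_le add_mono bd)
        ultimately show ?thesis by blast
      qed
      have "Ns * norm (x 0) \<le> N * norm (z 0)" "Nf * norm (y 0) \<le> N * norm (z 0)"
        using Ns Nf norm_fst_le[of "fst (z 0)" "snd (z 0)"] norm_snd_le[of "snd (z 0)" "fst (z 0)"]
        unfolding x_def y_def N_def by (intro mult_mono; simp)+
      then have init': "u 0 0 < \<rho>" "v 0 0 < \<rho>"
        using init Ns(2)[of "\<sigma> 0" "x 0"] Nf(2)[of "\<sigma> 0" "y 0"] by (auto simp: u_def v_def)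
      then have \<rho>: "\<rho> > 0" by (auto simp: u_def intro: order_le_less_trans[OF norm_ge_zero])
      then have "\<rho> \<le> m * \<rho>" using pos by simp
      then have init'': "v 0 0 < m * \<rho>" using init' by simp
      have uv: "u k s < (1 + \<kappa> * m) * (\<rho> * q ^ k)" "v k s < (m + \<kappa> * (1 + \<kappa> * m)) * (\<rho> * q ^ k)"
        by (rule hybrid_decay[OF t _ du dv jump, where T = T and \<rho> = \<rho>];
            use dwell init' init'' \<rho> pos C l sm q s in \<open>simp add: u_def v_def T_def a_def b_def\<close>)+
      have "norm (z s) \<le> norm (x s) + norm (y s)"
        using norm_Pair_le[of "x s" "y s"] by (simp add: x_def y_def)
      also have "\<dots> \<le> u k s + v k s"
        unfolding u_def v_def by (intro add_mono le_Ms le_Mf)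
      also have "\<dots> < D * (\<rho> * q ^ k)"
        using uv unfolding D_def by (simp add: distrib_right)
      finally show ?thesis .
    qed

    \<comment> \<open>From geometric decay to stability and attraction\<close>
    show ?thesis
      unfolding globally_asymptotically_stable_def
    proof (intro conjI allI impI ballI)
      fix \<rho> :: real assume \<rho>: "\<rho> > 0"
      show "\<exists>\<delta>>0. \<forall>z\<in>{z. solution_H A R \<epsilon> t \<sigma> \<nu> (\<lambda>s. fst (z s)) (\<lambda>s. snd (z s))}.
          norm (z 0) < \<delta> \<longrightarrow> (\<forall>s\<ge>0. norm (z s) < \<rho>)"
      \<comment> \<open>With this radius the decay estimate applies to \<open>\<rho> / D\<close>,
        and the factor \<open>D\<close> cancels.\<close>
      proof (intro exI[of _ "\<rho> / D / N"] conjI ballI impI allI)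
        show "\<rho> / D / N > 0" using \<rho> D N by simp
        fix z :: "real \<Rightarrow> (real^'nx) \<times> (real^'nz)" and s :: real
        assume z: "z \<in> {z. solution_H A R \<epsilon> t \<sigma> \<nu> (\<lambda>s. fst (z s)) (\<lambda>s. snd (z s))}"
          and "norm (z 0) < \<rho> / D / N" and "s \<ge> 0"
        then have "N * norm (z 0) < \<rho> / D" using N by (simp only: pos_less_divide_eq mult.commute)
        moreover obtain k where "s \<in> {t k..<t (Suc k)}"
          using event_times_locate[OF t, of 0 s] \<open>s \<ge> 0\<close> t by (auto simp: event_times_def)
        ultimately have "norm (z s) < D * (\<rho> / D * q ^ k)" using decay z by blast
        also have "\<dots> = \<rho> * q ^ k" using D by simp
        also have "\<dots> \<le> \<rho>" using q \<rho> by (simp add: power_le_one mult_left_le)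
        finally show "norm (z s) < \<rho>" .
      qed
    next
      fix z :: "real \<Rightarrow> (real^'nx) \<times> (real^'nz)"
      assume z: "z \<in> {z. solution_H A R \<epsilon> t \<sigma> \<nu> (\<lambda>s. fst (z s)) (\<lambda>s. snd (z s))}"
      \<comment> \<open>Adding \<open>1\<close> makes \<open>N * norm (z 0) < \<rho>\<close> strict
        and covers the zero initial state.\<close>
      define \<rho> where "\<rho> = N * norm (z 0) + 1"
      have \<rho>: "\<rho> > 0" using N by (simp add: \<rho>_def add_nonneg_pos)
      have "(\<lambda>k. D * (\<rho> * q ^ k)) \<longlonglongrightarrow> D * (\<rho> * 0)"
        using q by (intro tendsto_intros LIMSEQ_power_zero) auto
      then have lim: "(\<lambda>k. D * (\<rho> * q ^ k)) \<longlonglongrightarrow> 0" by simp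
      show "(z \<longlongrightarrow> 0) at_top"
      proof (rule tendstoI)
        fix e :: real assume "e > 0"
        then obtain n where n: "D * (\<rho> * q ^ n) < e"
          using order_tendstoD(2)[OF lim] by (auto simp: eventually_sequentially)
        \<comment> \<open>Times from \<open>t n\<close> on fall in intervals of index at least
          \<open>n\<close>, where the powers of \<open>q\<close> are at most
          \<open>q ^ n\<close>.\<close>
        have "dist (z s) 0 < e" if ns: "t n \<le> s" for s
        proof -
          obtain k where k: "k \<ge> n" "s \<in> {t k..<t (Suc k)}" using event_times_locate[OF t ns] by blast
          have "norm (z s) < D * (\<rho> * q ^ k)" using decay[of z \<rho> s k] z k by (simp add: \<rho>_def)
          also have "\<dots> \<le> D * (\<rho> * q ^ n)"
            using D \<rho> q k by (intro mult_left_mono power_decreasing) auto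
          finally show ?thesis using n by simp
        qed
        then show "\<forall>\<^sub>F s in at_top. dist (z s) 0 < e"
          unfolding eventually_at_top_linorder by blast
      qed
    qed
  qed
  have "O_eps \<epsilon>2 (\<lambda>_. 0)"
    unfolding O_eps_def using \<epsilon>2 by (intro bexI[of _ "\<epsilon>2 / 2"] exI[of _ 1]) auto
  \<comment> \<open>With \<open>\<eta>2 = 0\<close>, a dwell time \<open>\<tau>\<close> above the
    threshold makes every gap at least
    \<open>- \<epsilon> / lambda_f * ln \<epsilon>\<close>.\<close>
  moreover have "- \<epsilon> / lambda_f * ln \<epsilon> \<le> t (Suc k) - t k"
    if "\<exists>\<tau>. \<tau> > - \<epsilon> / lambda_f * ln \<epsilon> + 0 \<and> (\<forall>k. t (Suc k) - t k \<ge> \<tau>)" for \<epsilon> t k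
    using that by (metis add.right_neutral less_imp_le order_trans)
  ultimately show ?thesis
    using \<epsilon>2 gas by (intro exI[of _ \<epsilon>2] exI[of _ "\<lambda>_. 0"] conjI) auto
qed

end
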